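(* For any tree $T$, the generic graph $G_T$ is bi-strongly shellable (bi-SS).
   Context: A tree is a connected finite simple graph containing no cycle. For distinct vertices $i,j$ of a tree $T$, let $i=i_0,i_1,\dots,i_r=j$ be the unique path from $i$ to $j$; put $b(i,j)=i_1$ (begin) and $e(i,j)=i_{r-1}$ (end). The generic graph $G_T$ is the finite simple graph with vertex set $\{x_{i,j},x_{j,i}:\{i,j\}\in\mathcal{E}(T)\}$ (all these being distinct), in which $\{x_{i,k},x_{j,l}\}$ is an edge iff $i\neq j$, $k=b(i,j)$ and $l=e(i,j)$. A simplicial complex is strongly shellable if its facets can be arranged in a linear order $F_1,\dots,F_t$ such that for each pair $i<j$ there exists $k<j$ with $|F_j\setminus F_k|=1$ and $F_i\cap F_j\subseteq F_k\subseteq F_i\cup F_j$ (the complex with no faces is vacuously strongly shellable). For a simplicial complex $\Delta$ on vertex set $V$, the Alexander dual is $\Delta^\vee=\{V\setminus F:F\subseteq V,F\notin\Delta\}$. A simplicial complex $\Delta$ is bi-SS if both $\Delta$ and $\Delta^\vee$ are strongly shellable. A finite simple graph $G$ is bi-SS if the Stanley–Reisner complex of its edge ideal is bi-SS; this complex is the independence complex $\mathcal{I}(G)$, consisting of all subsets of $\mathcal{V}(G)$ containing no edge of $G$. *)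

theory Defs
  imports "Graph_Theory.Graph_Theory"
begin

text \<open>A finite simple graph is a \<^const>\<open>pair_graph\<close>: each edge is represented by its two arcs
  (i, j) and (j, i). The constant \<^const>\<open>tree\<close> of \<^theory>\<open>Graph_Theory.Digraph_Component\<close>
  cannot be used for such graphs, because it also counts the closed walk i, j, i as a cycle.
  The graph-theoretic cycles are exactly the closed walks captured by \<^const>\<open>pre_digraph.cycle\<close>
  that have length at least 3. Nonemptiness is part of \<^const>\<open>Digraph_Component.connected\<close>.\<close>

definition tree_graph :: "'a pair_pre_digraph \<Rightarrow> bool" where
  "tree_graph T \<longleftrightarrow> pair_graph T \<and> Digraph_Component.connected (with_proj T) \<and>
     \<not> (\<exists>p. pre_digraph.cycle (with_proj T) p \<and> 3 \<le> length p)"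

text \<open>The path \<open>i\<^sub>0, i\<^sub>1, \<dots>, i\<^sub>r\<close> is given by the list of its arcs
  \<open>(i\<^sub>0, i\<^sub>1), \<dots>, (i\<^bsub>r-1\<^esub>, i\<^sub>r)\<close>. It is meaningful for vertices of a tree only;
  \<open>path_begin\<close> and \<open>path_end\<close> moreover require distinct end points.\<close>

definition tree_path :: "'a pair_pre_digraph \<Rightarrow> 'a \<Rightarrow> 'a \<Rightarrow> ('a \<times> 'a) awalk" where
  "tree_path T i j = (THE p. pre_digraph.apath (with_proj T) i p j)"

definition path_begin :: "'a pair_pre_digraph \<Rightarrow> 'a \<Rightarrow> 'a \<Rightarrow> 'a" where
  "path_begin T i j = snd (hd (tree_path T i j))"

definition path_end :: "'a pair_pre_digraph \<Rightarrow> 'a \<Rightarrow> 'a \<Rightarrow> 'a" where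
  "path_end T i j = fst (last (tree_path T i j))"

text \<open>The vertex \<open>x\<^bsub>i,j\<^esub>\<close> is encoded as the arc (i, j) of T. The arc relation below is
  symmetric for a tree T, because \<open>path_begin T j i = path_end T i j\<close>.\<close>

definition generic_graph :: "'a pair_pre_digraph \<Rightarrow> ('a \<times> 'a) pair_pre_digraph" where
  "generic_graph T =
     \<lparr> pverts = parcs T,
       parcs = {((i, k), (j, l)) | i k j l. (i, k) \<in> parcs T \<and> (j, l) \<in> parcs T \<and>
                  i \<noteq> j \<and> k = path_begin T i j \<and> l = path_end T i j} \<rparr>"

definition facets :: "'v set set \<Rightarrow> 'v set set" where
  "facets \<Delta> = {F \<in> \<Delta>. \<forall>G \<in> \<Delta>. F \<subseteq> G \<longrightarrow> F = G}"

definition strongly_shellable :: "'v set set \<Rightarrow> bool" where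
  "strongly_shellable \<Delta> \<longleftrightarrow>
     (\<exists>Fs. distinct Fs \<and> set Fs = facets \<Delta> \<and>
        (\<forall>j < length Fs. \<forall>i < j. \<exists>k < j.
           card (Fs ! j - Fs ! k) = 1 \<and>
           Fs ! i \<inter> Fs ! j \<subseteq> Fs ! k \<and> Fs ! k \<subseteq> Fs ! i \<union> Fs ! j))"

definition alexander_dual :: "'v set \<Rightarrow> 'v set set \<Rightarrow> 'v set set" where
  "alexander_dual V \<Delta> = {V - F | F. F \<subseteq> V \<and> F \<notin> \<Delta>}"

definition bi_SS :: "'v set \<Rightarrow> 'v set set \<Rightarrow> bool" where
  "bi_SS V \<Delta> \<longleftrightarrow> strongly_shellable \<Delta> \<and> strongly_shellable (alexander_dual V \<Delta>)"

definition independence_complex :: "'v pair_pre_digraph \<Rightarrow> 'v set set" where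
  "independence_complex G = {S. S \<subseteq> pverts G \<and> (\<forall>u \<in> S. \<forall>v \<in> S. (u, v) \<notin> parcs G)}"

definition bi_SS_graph :: "'v pair_pre_digraph \<Rightarrow> bool" where
  "bi_SS_graph G \<longleftrightarrow> bi_SS (pverts G) (independence_complex G)"

end

theory Submission
  imports Defs
begin

text \<open>For an arc a = (i, k) of the tree let \<open>side a\<close> be the component of i after removing the edge
  {i, k}. Two arcs are adjacent in the generic graph iff their sides are disjoint, and any two sides
  are nested, disjoint, or cover the tree.

  By the Helly property of subtrees, the facets of the independence complex are the sets
  \<open>away r\<close> of all arcs pointing away from a vertex r. Moving r along an edge replaces one arc by its
  reverse, so ordering the vertices by their distance from a fixed root is a strong shelling.

  The facets of the dual are the complements of the edges {a, b} of the generic graph. Ordering these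
  edges by increasing w a + w b, for an injective weight w that is strictly monotone in the side, is a
  strong shelling: for two disjoint edges, some edge joining them precedes the later one.\<close>

section \<open>Strong shellability from a numerical key\<close>

text \<open>Sort the facets by \<open>\<kappa>\<close>. Ties may come in either order, so the
  exchange is required for both orders of two facets with equal key. A strictly smaller key forces
  \<open>H\<close> to precede \<open>G\<close>, and \<open>F\<close> itself precedes it by
  assumption.\<close>

lemma strongly_shellableI:
  fixes \<kappa> :: "'v set \<Rightarrow> nat"
  assumes fin: "finite (facets \<Delta>)"
    and step: "\<And>F G. F \<in> facets \<Delta> \<Longrightarrow> G \<in> facets \<Delta> \<Longrightarrow> F \<noteq> G \<Longrightarrow> \<kappa> F \<le> \<kappa> G \<Longrightarrow>
      \<exists>H \<in> facets \<Delta>. (H = F \<or> \<kappa> H < \<kappa> G) \<and> card (G - H) = 1 \<and> F \<inter> G \<subseteq> H \<and> H \<subseteq> F \<union> G"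
  shows "strongly_shellable \<Delta>"
proof -
  obtain xs where xs: "set xs = facets \<Delta>" "distinct xs"
    using finite_distinct_list[OF fin] by blast
  define Fs where "Fs = sort_key \<kappa> xs"
  have Fs: "set Fs = facets \<Delta>" "distinct Fs"
    using xs by (simp_all add: Fs_def)
  have mono: "\<kappa> (Fs ! i) \<le> \<kappa> (Fs ! j)" if "i \<le> j" "j < length Fs" for i j
    using sorted_nth_mono[of "map \<kappa> Fs" i j] that by (simp add: Fs_def)
  have "\<exists>k<j. card (Fs ! j - Fs ! k) = 1 \<and> Fs ! i \<inter> Fs ! j \<subseteq> Fs ! k \<and> Fs ! k \<subseteq> Fs ! i \<union> Fs ! j"
    if j: "j < length Fs" and i: "i < j" for i j
  proof -
    have "Fs ! i \<in> facets \<Delta>" "Fs ! j \<in> facets \<Delta>" "Fs ! i \<noteq> Fs ! j"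
      using Fs i j by (auto simp: nth_eq_iff_index_eq simp flip: Fs(1))
    with step mono i j obtain H where H: "H \<in> facets \<Delta>" "H = Fs ! i \<or> \<kappa> H < \<kappa> (Fs ! j)"
      "card (Fs ! j - H) = 1" "Fs ! i \<inter> Fs ! j \<subseteq> H" "H \<subseteq> Fs ! i \<union> Fs ! j"
      by (metis less_imp_le)
    obtain k where k: "k < length Fs" "H = Fs ! k"
      using H(1) Fs(1) by (metis in_set_conv_nth)
    consider "H = Fs ! i" | "k < j"
      using H(2) k mono[of j k] by (metis not_le)
    then show ?thesis
      using H k i by cases auto
  qed
  with Fs show ?thesis
    unfolding strongly_shellable_def by blast
qed

section \<open>Sides of the arcs of a tree\<close>

locale tree_digraph = pair_graph +
  assumes conn: "Digraph_Component.connected (with_proj G)"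
    and no_long_cycle: "cycle p \<Longrightarrow> length p < 3"
begin

text \<open>Arcs are encoded as pairs, so \<^term>\<open>prod.swap a\<close> is the reverse of the arc a.\<close>

definition cut :: "'a \<times> 'a \<Rightarrow> 'a rel" where
  "cut a = parcs G - {a, prod.swap a}"

definition side :: "'a \<times> 'a \<Rightarrow> 'a set" where
  "side a = {v. (fst a, v) \<in> (cut a)\<^sup>*}"

lemma swap_in_parcs [simp]: "prod.swap a \<in> parcs G \<longleftrightarrow> a \<in> parcs G"
  by (cases a) (auto dest: arcs_symmetric)

lemma verts_nonempty: "pverts G \<noteq> {}"
  using conn by (auto simp: Digraph_Component.connected_def strongly_connected_def)

lemma reachable_verts: "u \<rightarrow>\<^sup>*\<^bsub>with_proj G\<^esub> v" if "u \<in> pverts G" "v \<in> pverts G"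
proof -
  have "strongly_connected (with_proj G)"
    using symmetric_connected_imp_strongly_connected[OF _ conn] sym_arcs by blast
  then show ?thesis
    using that by (auto simp: strongly_connected_def)
qed

lemma exists_apath: "\<exists>p. apath u p v" if "u \<in> pverts G" "v \<in> pverts G"
  using reachable_verts[OF that] reachable_apath by blast

text \<open>Connectedness in the form used below: from a point of \<open>A\<close>, a path leads to
  every vertex without ever leaving \<open>A\<close>.\<close>

lemma closed_imp_all_verts:
  assumes "A \<subseteq> pverts G" "A \<noteq> {}" "\<And>u v. (u, v) \<in> parcs G \<Longrightarrow> u \<in> A \<Longrightarrow> v \<in> A"
  shows "A = pverts G"
proof -
  have "v \<in> A" if "u \<in> A" "awalk u p v" for u p v
    using that(2,1) assms(3) by (induction p arbitrary: u) (auto simp: awalk_simps)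
  then show ?thesis
    using assms(1,2) exists_apath awalkI_apath by blast
qed

lemma sym_cut: "sym (cut a)"
  by (rule symI) (cases a, auto simp: cut_def dest: arcs_symmetric)

lemma cut_rtrancl_sym: "(u, v) \<in> (cut a)\<^sup>* \<Longrightarrow> (v, u) \<in> (cut a)\<^sup>*"
  using sym_rtrancl[OF sym_cut] by (meson symE)

lemma cut_swap [simp]: "cut (prod.swap a) = cut a"
  by (auto simp: cut_def)

lemma apath_if_cut_rtrancl:
  assumes "(u, v) \<in> (cut a)\<^sup>*" "v \<in> pverts G"
  shows "\<exists>p. apath u p v \<and> set p \<subseteq> cut a"
proof -
  have "\<exists>p. awalk u p v \<and> set p \<subseteq> cut a"
    using assms(1)
  proof (induction rule: converse_rtrancl_induct)
    case base
    then show ?case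
      using assms(2) by (intro exI[of _ "[]"]) (auto simp: awalk_simps)
  next
    case (step y z)
    then obtain p where "awalk z p v" "set p \<subseteq> cut a"
      by blast
    then show ?case
      using step.hyps by (intro exI[of _ "(y, z) # p"]) (auto simp: awalk_simps cut_def)
  qed
  then show ?thesis
    using awalk_to_apath_subset apath_awalk_to_apath by (meson subset_trans)
qed

lemma fst_in_side [simp]: "fst a \<in> side a"
  by (simp add: side_def)

text \<open>Here acyclicity enters: a path from the head of \<open>a\<close> back to its tail that
  avoids both orientations of \<open>a\<close> would close up with \<open>a\<close> to a cycle of
  length at least 3.\<close>

lemma snd_notin_side:
  assumes "a \<in> parcs G"
  shows "snd a \<notin> side a"
proof
  assume "snd a \<in> side a"
  then have "(snd a, fst a) \<in> (cut a)\<^sup>*"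
    by (auto simp: side_def intro: cut_rtrancl_sym)
  then obtain p where p: "apath (snd a) p (fst a)" "set p \<subseteq> cut a"
    using apath_if_cut_rtrancl assms by (metis arc_fst_in_verts)
  have "snd a \<noteq> fst a"
    using assms pair_no_loops by fastforce
  with p have "p \<noteq> []"
    by (auto simp: apath_simps)
  \<comment> \<open>A single arc from \<open>snd a\<close> to \<open>fst a\<close> would be the
    reverse of \<open>a\<close>, which \<open>cut a\<close> omits.\<close>
  moreover have "p \<noteq> [b]" for b
    using p by (cases a) (auto simp: apath_simps cut_def)
  ultimately have "3 \<le> length (a # p)"
    by (cases p rule: remdups_adj.cases) auto
  moreover have "cycle (a # p)"
    unfolding cycle_def using p assms
    by (intro exI[of _ "fst a"]) (auto simp: awalk_simps apath_def)
  ultimately show False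
    using no_long_cycle by (meson not_le)
qed

lemma side_closed: "u \<in> side a \<Longrightarrow> (u, v) \<in> cut a \<Longrightarrow> v \<in> side a"
  by (auto simp: side_def)

text \<open>A common vertex would connect both ends of \<open>a\<close> within the cut. The union is
  everything because it is closed under arcs: those outside the cut end in \<open>fst a\<close> or
  \<open>snd a\<close>.\<close>

lemma side_swap:
  assumes "a \<in> parcs G"
  shows "side (prod.swap a) = pverts G - side a"
proof -
  have sub: "side b \<subseteq> pverts G" if "b \<in> parcs G" for b
  proof
    fix v assume "v \<in> side b"
    then have "(fst b, v) \<in> (cut b)\<^sup>*" by (simp add: side_def)
    then show "v \<in> pverts G"
      by (induction rule: rtrancl_induct) (use that in \<open>auto simp: cut_def intro: arc_fst_in_verts in_arcsD2\<close>)
  qed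
  have "side a \<inter> side (prod.swap a) = {}"
  proof (rule ccontr)
    assume "side a \<inter> side (prod.swap a) \<noteq> {}"
    then obtain v where "(fst a, v) \<in> (cut a)\<^sup>*" "(snd a, v) \<in> (cut a)\<^sup>*"
      by (auto simp: side_def)
    then have "snd a \<in> side a"
      unfolding side_def using cut_rtrancl_sym rtrancl_trans by fast
    with snd_notin_side assms show False by blast
  qed
  moreover have "side a \<union> side (prod.swap a) = pverts G"
  proof (rule closed_imp_all_verts)
    show "side a \<union> side (prod.swap a) \<noteq> {}"
      using fst_in_side by blast
    fix u v assume uv: "(u, v) \<in> parcs G" "u \<in> side a \<union> side (prod.swap a)"
    show "v \<in> side a \<union> side (prod.swap a)"
    proof (cases "(u, v) \<in> cut a")
      case True
      then show ?thesis
        using uv side_closed[of u a v] side_closed[of u "prod.swap a" v] by auto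
    next
      case False
      then have "v = fst a \<or> v = fst (prod.swap a)"
        using uv by (cases a) (auto simp: cut_def)
      then show ?thesis
        using fst_in_side by blast
    qed
  qed (use sub assms in auto)
  ultimately show ?thesis by blast
qed

lemma side_subset_verts: "a \<in> parcs G \<Longrightarrow> side a \<subseteq> pverts G"
  using side_swap[of "prod.swap a"] by auto

text \<open>Only \<open>a\<close> and its reverse are missing from the cut, and the reverse starts
  outside the side.\<close>

lemma arc_leaving_side:
  assumes "a \<in> parcs G" "(u, v) \<in> parcs G" "u \<in> side a" "v \<notin> side a"
  shows "a = (u, v)"
  using side_closed[of u a v] assms snd_notin_side[OF assms(1)]
  by (cases a) (auto simp: cut_def)

lemma side_inject: "a \<in> parcs G \<Longrightarrow> b \<in> parcs G \<Longrightarrow> side a = side b \<Longrightarrow> a = b"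
  by (metis arc_leaving_side fst_in_side snd_notin_side prod.collapse)

lemma fst_in_side_iff:
  assumes "a \<in> parcs G" "b \<in> parcs G" "a \<noteq> b" "a \<noteq> prod.swap b"
  shows "fst b \<in> side a \<longleftrightarrow> snd b \<in> side a"
  using assms arc_leaving_side[of a "fst b" "snd b"] arc_leaving_side[of a "snd b" "fst b"]
    swap_in_parcs[of b]
  by (cases b) auto

text \<open>If neither side contains the tail of the other arc, no arc leaves the intersection: it
  would have to be \<open>a\<close> or \<open>b\<close>, whose tails are not in it. By connectedness
  a nonempty intersection would then be the whole tree.\<close>

lemma sides_disjoint_iff:
  assumes "a \<in> parcs G" "b \<in> parcs G"
  shows "side a \<inter> side b = {} \<longleftrightarrow> fst b \<notin> side a \<and> fst a \<notin> side b"
proof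
  assume R: "fst b \<notin> side a \<and> fst a \<notin> side b"
  show "side a \<inter> side b = {}"
  proof (rule ccontr)
    assume "side a \<inter> side b \<noteq> {}"
    moreover have "v \<in> side a \<inter> side b" if "(u, v) \<in> parcs G" "u \<in> side a \<inter> side b" for u v
      using R arc_leaving_side[OF assms(1) that(1)] arc_leaving_side[OF assms(2) that(1)] that(2)
      by (metis Int_iff fst_conv)
    ultimately have "side a \<inter> side b = pverts G"
      using side_subset_verts[OF assms(1)] by (intro closed_imp_all_verts) auto
    then show False
      using R assms by (metis IntD1 arc_fst_in_verts)
  qed
qed (use fst_in_side in blast)

text \<open>Apart from equal or opposite arcs, the positions of each tail relative to the other side
  give four cases. In each, \<open>sides_disjoint_iff\<close> applies to \<open>a\<close> or its
  reverse together with \<open>b\<close> or its reverse, and reversal complements the side.\<close>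

lemma sides_compatible:
  assumes "a \<in> parcs G" "b \<in> parcs G"
  shows "side a \<subseteq> side b \<or> side b \<subseteq> side a \<or> side a \<inter> side b = {} \<or> side a \<union> side b = pverts G"
proof (cases "a = b \<or> a = prod.swap b")
  case True
  then show ?thesis
    using side_swap[OF assms(2)] side_subset_verts[OF assms(2)] by auto
next
  case False
  then have F: "a \<noteq> b" "a \<noteq> prod.swap b" "b \<noteq> a" "b \<noteq> prod.swap a"
    by auto
  have iff: "fst b \<in> side a \<longleftrightarrow> snd b \<in> side a" "fst a \<in> side b \<longleftrightarrow> snd a \<in> side b"
    using fst_in_side_iff assms F by blast+
  have V: "side a \<subseteq> pverts G" "side b \<subseteq> pverts G" "fst a \<in> pverts G" "fst b \<in> pverts G"
    "snd a \<in> pverts G" "snd b \<in> pverts G"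
    using side_subset_verts assms arc_fst_in_verts arc_snd_in_verts by auto
  show ?thesis
    using sides_disjoint_iff[of a b] sides_disjoint_iff[of "prod.swap a" b]
      sides_disjoint_iff[of a "prod.swap b"] sides_disjoint_iff[of "prod.swap a" "prod.swap b"]
      assms iff V side_swap
    by (cases "fst b \<in> side a"; cases "fst a \<in> side b") auto
qed

section \<open>Paths in the tree and adjacency in the generic graph\<close>

text \<open>After its first arc the path never returns to \<open>i\<close>, so the position of
  \<open>j\<close> relative to any arc at \<open>i\<close> is decided by that first arc.\<close>

lemma apath_hd_iff:
  assumes "apath i p j" "i \<noteq> j" "(i, k) \<in> parcs G"
  shows "snd (hd p) = k \<longleftrightarrow> j \<notin> side (i, k)"
proof -
  obtain k' q where p: "p = (i, k') # q" "(i, k') \<in> parcs G" "apath k' q j" "i \<notin> set (pawalk_verts k' q)"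
    using assms(1,2) by (cases p) (auto simp: apath_simps)
  \<comment> \<open>The rest of the path avoids \<open>i\<close>, hence both orientations of every
    edge at \<open>i\<close>. The cases below take \<open>l\<close> to be \<open>k'\<close> and
    \<open>k\<close>.\<close>
  have q: "(k', j) \<in> (cut (i, l))\<^sup>*" for l
  proof -
    have "awalk k' q j" "i \<notin> set (pawalk_verts k' q)"
      using p by (auto simp: apath_def)
    then show ?thesis
    proof (induction q arbitrary: k')
      case (Cons e q)
      obtain x where e: "e = (k', x)" "(k', x) \<in> parcs G" "awalk x q j"
        using Cons.prems by (cases e) (auto simp: awalk_simps)
      have "x \<noteq> i"
        using hd_in_awalk_verts(1)[OF e(3)] Cons.prems e by auto
      then have "(k', x) \<in> cut (i, l)"
        using Cons.prems e by (auto simp: cut_def)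
      moreover have "(x, j) \<in> (cut (i, l))\<^sup>*"
        using Cons.IH[OF e(3)] Cons.prems e by auto
      ultimately show ?case by simp
    qed (simp add: awalk_simps)
  qed
  show ?thesis
  proof (cases "k = k'")
    case True
    have "j \<in> side (prod.swap (i, k'))"
      using q[of k'] cut_swap[of "(i, k')"] by (simp add: side_def)
    then show ?thesis
      using True p side_swap[of "(i, k')"] by auto
  next
    case False
    have "(i, k') \<in> cut (i, k)"
      using False p pair_no_loops by (fastforce simp: cut_def)
    then have "j \<in> side (i, k)"
      using q[of k] by (auto simp: side_def)
    then show ?thesis
      using False p by auto
  qed
qed

text \<open>By \<open>apath_hd_iff\<close> the first arc is determined by the sides alone,
  independently of the path.\<close>

lemma apath_unique: "apath i p j \<Longrightarrow> apath i q j \<Longrightarrow> p = q"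
proof (induction p arbitrary: i q)
  case Nil
  then show ?case
    using apath_nonempty_ends[of i q j] by (auto simp: apath_simps)
next
  case (Cons e p)
  have "i \<noteq> j"
    using apath_nonempty_ends Cons.prems by blast
  then obtain f q' where q: "q = f # q'"
    using Cons.prems by (cases q) (auto simp: apath_simps)
  have e: "e = (i, snd e)" "e \<in> parcs G" and f: "f = (i, snd f)" "f \<in> parcs G"
    using Cons.prems q by (auto simp: apath_simps prod_eq_iff)
  have "snd f = snd e"
    using apath_hd_iff[OF Cons.prems(1) \<open>i \<noteq> j\<close>, of "snd e"]
      apath_hd_iff[OF Cons.prems(2) \<open>i \<noteq> j\<close>, of "snd e"] e q by auto
  with e f have "e = f" by metis
  then show ?case
    using Cons q by (auto simp: apath_simps)
qed

lemma tree_path_eq: "apath i p j \<Longrightarrow> tree_path G i j = p"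
  unfolding tree_path_def by (rule the_equality) (auto intro: apath_unique)

lemma path_begin_iff:
  assumes "i \<noteq> j" "j \<in> pverts G" "(i, k) \<in> parcs G"
  shows "k = path_begin G i j \<longleftrightarrow> j \<notin> side (i, k)"
proof -
  obtain p where "apath i p j"
    using exists_apath assms in_arcsD1 by blast
  then show ?thesis
    using apath_hd_iff assms by (auto simp: path_begin_def tree_path_eq)
qed

lemma path_end_eq_path_begin:
  assumes "i \<noteq> j" "i \<in> pverts G" "j \<in> pverts G"
  shows "path_end G i j = path_begin G j i"
proof -
  obtain p where p: "apath i p j"
    using exists_apath assms by blast
  then have "apath j (rev_path p) i" by simp
  moreover have "p \<noteq> []"
    using p assms by (auto simp: apath_simps)
  moreover have "snd (hd (rev_path p)) = fst (last p)" if "p \<noteq> []" for p :: "('a \<times> 'a) list"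
    using that by (induction p) (auto simp: hd_append)
  ultimately show ?thesis
    using tree_path_eq[OF p] tree_path_eq[of j "rev_path p" i]
    by (simp add: path_begin_def path_end_def)
qed

text \<open>The conditions on begin and end say that neither tail lies on the side of the other arc,
  which is \<open>sides_disjoint_iff\<close>. Arcs with a common tail have sides meeting
  there.\<close>

lemma parcs_generic_graph:
  "parcs (generic_graph G) = {(a, b). a \<in> parcs G \<and> b \<in> parcs G \<and> side a \<inter> side b = {}}"
proof -
  have "fst a \<noteq> fst b \<and> snd a = path_begin G (fst a) (fst b) \<and> snd b = path_end G (fst a) (fst b)
      \<longleftrightarrow> side a \<inter> side b = {}" if "a \<in> parcs G" "b \<in> parcs G" for a b
  proof (cases "fst a = fst b")
    case True
    then show ?thesis
      using fst_in_side by (metis disjoint_iff)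
  next
    case False
    then show ?thesis
      using that path_begin_iff[of "fst a" "fst b" "snd a"] path_begin_iff[of "fst b" "fst a" "snd b"]
        path_end_eq_path_begin[of "fst a" "fst b"] arc_fst_in_verts
      by (auto simp: sides_disjoint_iff)
  qed
  then show ?thesis
    unfolding generic_graph_def by fastforce
qed

section \<open>Facets of the independence complex\<close>

lemma exists_separating_arc:
  assumes "r \<in> pverts G" "s \<in> pverts G" "r \<noteq> s"
  obtains k where "(r, k) \<in> parcs G" "s \<notin> side (r, k)"
proof -
  obtain p where p: "apath r p s"
    using exists_apath assms by blast
  then obtain k q where "p = (r, k) # q" "(r, k) \<in> parcs G"
    using assms by (cases p) (auto simp: apath_simps)
  then show ?thesis
    using that apath_hd_iff[OF p] assms by auto
qed

lemma independence_complex_iff: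
  "S \<in> independence_complex (generic_graph G) \<longleftrightarrow>
     S \<subseteq> parcs G \<and> (\<forall>a \<in> S. \<forall>b \<in> S. side a \<inter> side b \<noteq> {})"
  unfolding independence_complex_def parcs_generic_graph
  by (simp add: generic_graph_def) blast

definition away :: "'a \<Rightarrow> ('a \<times> 'a) set" where
  "away r = {a \<in> parcs G. r \<in> side a}"

lemma independent_subset_away:
  assumes "S \<in> independence_complex (generic_graph G)"
  shows "\<exists>r \<in> pverts G. S \<subseteq> away r"
proof (cases "S = {}")
  case True
  then show ?thesis
    using verts_nonempty by blast
next
  case False
  have S: "S \<subseteq> parcs G" "\<And>a b. a \<in> S \<Longrightarrow> b \<in> S \<Longrightarrow> side a \<inter> side b \<noteq> {}"
    using assms by (auto simp: independence_complex_iff)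
  have fin: "finite (side a)" if "a \<in> S" for a
    using that S(1) by (intro finite_subset[OF side_subset_verts pair_finite_verts]) auto
  obtain a where a: "a \<in> S" "\<And>b. b \<in> S \<Longrightarrow> card (side a) \<le> card (side b)"
  proof -
    obtain a where "a \<in> S"
      using False by blast
    from ex_has_least_nat[of "\<lambda>a. a \<in> S", OF this, of "\<lambda>a. card (side a)"] that
    show thesis by blast
  qed
  \<comment> \<open>The tail of an arc with a smallest side lies on every other side.\<close>
  have "fst a \<in> side b" if b: "b \<in> S" for b
  proof (rule ccontr)
    assume N: "fst a \<notin> side b"
    \<comment> \<open>Opposite arcs have complementary, hence disjoint, sides, against
      independence.\<close>
    have "a \<noteq> prod.swap b"
      using S b a N side_swap[of b] by (metis Diff_disjoint Int_commute subsetD)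
    moreover from this have "b \<noteq> prod.swap a"
      by auto
    moreover have "a \<noteq> b"
      using N by auto
    moreover have "fst b \<in> side a"
      using sides_disjoint_iff[of a b] S a b N by blast
    ultimately have "snd b \<in> side a" "snd a \<notin> side b"
      using fst_in_side_iff[of a b] fst_in_side_iff[of b a] S a b N by auto
    then have "side (prod.swap a) \<inter> side b = {}"
      using sides_disjoint_iff[of "prod.swap a" b] side_swap[of a] S a b \<open>fst b \<in> side a\<close> by auto
    \<comment> \<open>The inclusion is proper because of \<open>fst a\<close>; this contradicts the
      minimal size of \<open>side a\<close>.\<close>
    then have "side b \<subset> side a"
      using side_swap[of a] side_subset_verts[of b] S a b N by auto
    then have "card (side b) < card (side a)"
      using fin a by (intro psubset_card_mono) auto
    with a(2)[OF b] show False
      by simp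
  qed
  then show ?thesis
    using S a arc_fst_in_verts by (intro bexI[of _ "fst a"]) (auto simp: away_def)
qed

lemma away_independent: "away r \<in> independence_complex (generic_graph G)"
  by (auto simp: independence_complex_iff away_def)

text \<open>The first arc on the path from \<open>r\<close> to \<open>s\<close> points away from
  \<open>r\<close> but not from \<open>s\<close>.\<close>

lemma away_subset_imp_eq:
  assumes "r \<in> pverts G" "s \<in> pverts G" "away r \<subseteq> away s"
  shows "r = s"
proof (rule ccontr)
  assume "r \<noteq> s"
  then obtain k where "(r, k) \<in> parcs G" "s \<notin> side (r, k)"
    using exists_separating_arc assms by metis
  then show False
    using assms(3) fst_in_side[of "(r, k)"] by (auto simp: away_def)
qed

lemma facets_independence_complex:
  "facets (independence_complex (generic_graph G)) = away ` pverts G"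
proof
  show "facets (independence_complex (generic_graph G)) \<subseteq> away ` pverts G"
    using independent_subset_away away_independent by (fastforce simp: facets_def)
  show "away ` pverts G \<subseteq> facets (independence_complex (generic_graph G))"
  proof
    fix F assume "F \<in> away ` pverts G"
    then obtain r where r: "r \<in> pverts G" "F = away r"
      by blast
    have "away r = S" if "S \<in> independence_complex (generic_graph G)" "away r \<subseteq> S" for S
      using independent_subset_away[OF that(1)] that(2) away_subset_imp_eq[OF r(1)]
      by (metis subset_antisym subset_trans)
    then show "F \<in> facets (independence_complex (generic_graph G))"
      using r away_independent by (auto simp: facets_def)
  qed
qed

section \<open>Shelling the independence complex by distance from a root\<close>

lemma away_adjacent:
  assumes "(j, k) \<in> parcs G"
  shows "away k = insert (k, j) (away j - {(j, k)})"
proof -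
  have kj: "(k, j) \<in> parcs G" "j \<notin> side (k, j)" "k \<notin> side (j, k)"
    using assms arcs_symmetric snd_notin_side[of "(k, j)"] snd_notin_side[of "(j, k)"] by auto
  have "j \<in> side a \<longleftrightarrow> k \<in> side a" if "a \<in> parcs G" "a \<noteq> (j, k)" "a \<noteq> (k, j)" for a
    using fst_in_side_iff[OF that(1) assms] that by simp
  then show ?thesis
    using assms kj fst_in_side[of "(k, j)"] by (auto simp: away_def)
qed

lemma finite_away: "finite (away r)"
  using pair_finite_arcs by (simp add: away_def)

lemma independence_complex_strongly_shellable:
  "strongly_shellable (independence_complex (generic_graph G))"
proof -
  obtain r where r: "r \<in> pverts G"
    using verts_nonempty by blast
  show ?thesis
    \<comment> \<open>\<^term>\<open>card (away r - away j)\<close> is the distance between r and j.\<close>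
  proof (rule strongly_shellableI[where \<kappa> = "\<lambda>F. card (away r - F)"])
    show "finite (facets (independence_complex (generic_graph G)))"
      using pair_finite_verts by (simp add: facets_independence_complex)
    fix F H
    assume "F \<in> facets (independence_complex (generic_graph G))"
      "H \<in> facets (independence_complex (generic_graph G))" "F \<noteq> H"
      and le: "card (away r - F) \<le> card (away r - H)"
    then obtain i j where ij: "i \<in> pverts G" "j \<in> pverts G" "i \<noteq> j" "F = away i" "H = away j"
      unfolding facets_independence_complex by blast
    \<comment> \<open>The witness facet is \<open>away k\<close>, where \<open>k\<close> is the
      neighbour of \<open>j\<close> towards \<open>i\<close>.\<close>
    obtain k where k: "(j, k) \<in> parcs G" "i \<notin> side (j, k)"
      using exists_separating_arc ij by metis
    have kj: "(k, j) \<in> parcs G" "i \<in> side (k, j)"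
      using k ij side_swap[of "(j, k)"] arcs_symmetric by auto
    have jk: "j \<in> side (j, k)" "j \<notin> side (k, j)" "(k, j) \<noteq> (j, k)"
      using fst_in_side[of "(j, k)"] snd_notin_side[OF kj(1)] k kj by auto
    \<comment> \<open>Otherwise \<open>j\<close> lies between \<open>r\<close> and \<open>i\<close>:
      every arc in \<open>away r - away j\<close> is in \<open>away r - away i\<close>, and so is
      \<open>(j, k)\<close>. Then \<open>i\<close> would be farther from \<open>r\<close> than
      \<open>j\<close>.\<close>
    have "r \<notin> side (j, k)"
    proof
      assume r': "r \<in> side (j, k)"
      have "i \<notin> side a" if a: "a \<in> parcs G" "r \<in> side a" "j \<notin> side a" for a
      proof
        assume i: "i \<in> side a"
        \<comment> \<open>Both sides contain \<open>r\<close>, while \<open>i\<close> and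
          \<open>j\<close> rule out the two inclusions.\<close>
        have "side a \<union> side (j, k) = pverts G"
          using sides_compatible[OF a(1) k(1)] a r' i k jk by blast
        then have "k \<in> side a"
          using snd_notin_side[OF k(1)] in_arcsD2[OF k(1)] by auto
        then have "a = (k, j)"
          using arc_leaving_side a kj by blast
        then show False
          using a r' side_swap[OF k(1)] by auto
      qed
      then have "away r - away j \<subset> away r - away i"
        using k r' jk by (auto simp: away_def)
      then have "card (away r - away j) < card (away r - away i)"
        using finite_away by (intro psubset_card_mono) auto
      with le ij show False by simp
    qed
    then have "(k, j) \<in> away r" "(j, k) \<notin> away r"
      using r side_swap[OF k(1)] kj by (auto simp: away_def)
    then have "away r - away k \<subset> away r - away j"
      using away_adjacent[OF k(1)] jk by (auto simp: away_def)
    then have "card (away r - away k) < card (away r - away j)"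
      using finite_away by (intro psubset_card_mono) auto
    moreover have "away j - away k = {(j, k)}"
      using away_adjacent[OF k(1)] jk k by (auto simp: away_def)
    moreover have "away i \<inter> away j \<subseteq> away k" "away k \<subseteq> away i \<union> away j"
      using away_adjacent[OF k(1)] k kj by (auto simp: away_def)
    moreover have "away k \<in> facets (independence_complex (generic_graph G))"
      using in_arcsD2[OF k(1)] by (simp add: facets_independence_complex)
    ultimately show "\<exists>K \<in> facets (independence_complex (generic_graph G)).
        (K = F \<or> card (away r - K) < card (away r - H)) \<and> card (H - K) = 1 \<and>
        F \<inter> H \<subseteq> K \<and> K \<subseteq> F \<union> H"
      using ij by (intro bexI[of _ "away k"]) simp_all
  qed
qed

section \<open>Weights on arcs and exchange between disjoint edges\<close>

lemma exists_side_weight: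
  obtains w :: "'a \<times> 'a \<Rightarrow> nat" where "inj_on w (parcs G)"
    "\<And>a b. a \<in> parcs G \<Longrightarrow> b \<in> parcs G \<Longrightarrow> side a \<subset> side b \<Longrightarrow> w a < w b"
proof -
  obtain f :: "'a \<times> 'a \<Rightarrow> nat" and n where f: "f ` parcs G = {i. i < n}" "inj_on f (parcs G)"
    using finite_imp_inj_to_nat_seg[OF pair_finite_arcs] by metis
  \<comment> \<open>A lexicographic key: the size of the side first, then the numbering
    \<open>f\<close> below \<open>n\<close> to break ties.\<close>
  define w where "w a = card (side a) * n + f a" for a
  have lt: "f a < n" if "a \<in> parcs G" for a
    using f that by blast
  show thesis
  proof
    show "inj_on w (parcs G)"
    proof (rule inj_onI)
      fix a b assume ab: "a \<in> parcs G" "b \<in> parcs G" "w a = w b"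
      then have "w a mod n = w b mod n" by simp
      then have "f a = f b"
        using lt ab by (simp add: w_def)
      then show "a = b"
        using f ab by (meson inj_onD)
    qed
    fix a b assume ab: "a \<in> parcs G" "b \<in> parcs G" "side a \<subset> side b"
    then have "card (side a) < card (side b)"
      using pair_finite_verts side_subset_verts[OF ab(2)]
      by (intro psubset_card_mono) (auto intro: finite_subset)
    then have "Suc (card (side a)) * n \<le> card (side b) * n"
      by (intro mult_le_mono1) simp
    then show "w a < w b"
      using lt[OF ab(1)] by (simp add: w_def)
  qed
qed

text \<open>Compare \<open>side a\<close> with \<open>side c\<close>. If \<open>side a\<close> is
  the smaller, it misses \<open>side d\<close>; if \<open>side c\<close> is, it misses
  \<open>side b\<close>; if they cover the tree, \<open>side b\<close> lies in \<open>side c\<close>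
  and misses \<open>side d\<close>.\<close>

lemma disjoint_sides_cross:
  assumes abcd: "a \<in> parcs G" "b \<in> parcs G" "c \<in> parcs G" "d \<in> parcs G"
    and ab: "side a \<inter> side b = {}" and cd: "side c \<inter> side d = {}"
  shows "side a \<inter> side c = {} \<or> side a \<inter> side d = {} \<or> side b \<inter> side c = {} \<or> side b \<inter> side d = {}"
  using sides_compatible[OF abcd(1,3)] sides_compatible[OF abcd(1,4)] ab cd
    side_subset_verts[OF abcd(2)] side_subset_verts[OF abcd(4)]
  by blast

lemma disjoint_sides_exchange:
  fixes w :: "'a \<times> 'a \<Rightarrow> nat"
  assumes abcd: "a \<in> parcs G" "b \<in> parcs G" "c \<in> parcs G" "d \<in> parcs G"
    and w: "inj_on w (parcs G)"
      "\<And>a b. a \<in> parcs G \<Longrightarrow> b \<in> parcs G \<Longrightarrow> side a \<subset> side b \<Longrightarrow> w a < w b"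
    and ab: "side a \<inter> side b = {}" and cd: "side c \<inter> side d = {}"
    and disj: "{a, b} \<inter> {c, d} = {}" and le: "w a + w b \<le> w c + w d"
  shows "\<exists>x \<in> {a, b}. \<exists>y \<in> {c, d}. side x \<inter> side y = {} \<and> w x + w y < w c + w d"
proof -
  \<comment> \<open>One joining edge may be taken to be \<open>{a, c}\<close>; the other three
    choices follow by renaming.\<close>
  have key: "\<exists>x \<in> {a, b}. \<exists>y \<in> {c, d}. side x \<inter> side y = {} \<and> w x + w y < w c + w d"
    if abcd: "a \<in> parcs G" "b \<in> parcs G" "c \<in> parcs G" "d \<in> parcs G"
      and ab: "side a \<inter> side b = {}" and cd: "side c \<inter> side d = {}"
      and disj: "{a, b} \<inter> {c, d} = {}" and le: "w a + w b \<le> w c + w d"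
      and ac: "side a \<inter> side c = {}" for a b c d
  proof (rule ccontr)
    assume *: "\<not> (\<exists>x \<in> {a, b}. \<exists>y \<in> {c, d}. side x \<inter> side y = {} \<and> w x + w y < w c + w d)"
    have "w a \<noteq> w d" "w b \<noteq> w c"
      using disj abcd w(1) by (auto dest: inj_onD)
    \<comment> \<open>Since \<open>{a, c}\<close> is not light enough, \<open>w d \<le> w a\<close>,
      strictly by injectivity; the bound on the sums then gives the second inequality.\<close>
    then have "w d < w a" "w b < w c"
      using * ac le by (auto simp: not_less)
    have ne: "side b \<noteq> side d" "side a \<noteq> side d"
      using disj abcd side_inject by blast+
    \<comment> \<open>In the first three cases \<open>{b, c}\<close>, \<open>{a, d}\<close> and
      \<open>{b, d}\<close>, respectively, are joining edges that would have to be too heavy, which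
      the weights refute. In the last case \<open>side a\<close> lies in \<open>side d\<close>,
      against \<open>w d < w a\<close>.\<close>
    from sides_compatible[OF abcd(2,4)]
    consider "side b \<subset> side d" | "side d \<subset> side b" | "side b \<inter> side d = {}"
      | "side b \<union> side d = pverts G"
      using ne by blast
    then show False
    proof cases
      case 1
      then have "side b \<inter> side c = {}" "w b < w d"
        using cd w(2) abcd by auto
      then show False using * by auto
    next
      case 2
      then have "side a \<inter> side d = {}" "w d < w b"
        using ab w(2) abcd by auto
      then have "w c \<le> w a" using * by auto
      then show False using \<open>w d < w b\<close> le by simp
    next
      case 3
      then show False using * \<open>w b < w c\<close> by auto
    next
      case 4
      then have "side a \<subset> side d"
        using ab ne side_subset_verts[OF abcd(1)] by blast
      then show False
        using w(2)[OF abcd(1,4)] \<open>w d < w a\<close> by simp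
    qed
  qed
  from disjoint_sides_cross[OF abcd ab cd]
  show ?thesis
  proof (elim disjE)
    assume "side a \<inter> side c = {}"
    with key[of a b c d] assms show ?thesis by blast
  next
    assume "side a \<inter> side d = {}"
    with key[of a b d c] assms show ?thesis
      by (auto simp: Int_commute insert_commute add.commute)
  next
    assume "side b \<inter> side c = {}"
    with key[of b a c d] assms show ?thesis
      by (auto simp: Int_commute insert_commute add.commute)
  next
    assume "side b \<inter> side d = {}"
    with key[of b a d c] assms show ?thesis
      by (auto simp: Int_commute insert_commute add.commute)
  qed
qed

section \<open>Shelling the Alexander dual\<close>

text \<open>Faces of the dual are the sets whose complement contains an edge of the generic graph,
  so the maximal ones omit exactly the two ends of one edge.\<close>

lemma facets_alexander_dual:
  "facets (alexander_dual (parcs G) (independence_complex (generic_graph G))) =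
     {parcs G - {a, b} | a b. a \<in> parcs G \<and> b \<in> parcs G \<and> side a \<inter> side b = {}}"
  (is "facets ?D = ?R")
proof -
  have D: "F \<in> ?D \<longleftrightarrow> F \<subseteq> parcs G \<and>
      (\<exists>a b. a \<in> parcs G - F \<and> b \<in> parcs G - F \<and> side a \<inter> side b = {})" for F
  proof
    assume "F \<in> ?D"
    then show "F \<subseteq> parcs G \<and> (\<exists>a b. a \<in> parcs G - F \<and> b \<in> parcs G - F \<and> side a \<inter> side b = {})"
      unfolding alexander_dual_def independence_complex_iff by blast
  next
    assume F: "F \<subseteq> parcs G \<and> (\<exists>a b. a \<in> parcs G - F \<and> b \<in> parcs G - F \<and> side a \<inter> side b = {})"
    then have "parcs G - F \<notin> independence_complex (generic_graph G)"
      unfolding independence_complex_iff by blast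
    moreover have "F = parcs G - (parcs G - F)"
      using F by blast
    ultimately show "F \<in> ?D"
      unfolding alexander_dual_def by blast
  qed
  have R: "F \<in> ?D" if "F \<in> ?R" for F
    using that unfolding D by blast
  show ?thesis
  proof
    show "facets ?D \<subseteq> ?R"
    proof
      fix F assume F: "F \<in> facets ?D"
      then obtain a b where ab: "F \<subseteq> parcs G" "a \<in> parcs G - F" "b \<in> parcs G - F" "side a \<inter> side b = {}"
        by (auto simp: facets_def D)
      then have "parcs G - {a, b} \<in> ?R" by blast
      moreover from R[OF this] have "F = parcs G - {a, b}"
        using F ab by (auto simp: facets_def)
      ultimately show "F \<in> ?R" by simp
    qed
    show "?R \<subseteq> facets ?D"
    proof
      fix F assume F: "F \<in> ?R"
      have "F = H" if H: "H \<in> ?D" "F \<subseteq> H" for H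
      proof -
        obtain a b where ab: "F = parcs G - {a, b}" using F by blast
        obtain c d where cd: "H \<subseteq> parcs G" "c \<in> parcs G - H" "d \<in> parcs G - H" "side c \<inter> side d = {}"
          using H by (auto simp: D)
        \<comment> \<open>\<open>H\<close> omits two distinct arcs and \<open>F\<close> at most two,
          so \<open>F \<subseteq> H\<close> leaves only equality.\<close>
        have "c \<noteq> d"
          using cd(4) fst_in_side by blast
        then show ?thesis
          using H cd ab by blast
      qed
      then show "F \<in> facets ?D"
        using R[OF F] by (simp add: facets_def)
    qed
  qed
qed

lemma alexander_dual_strongly_shellable:
  "strongly_shellable (alexander_dual (parcs G) (independence_complex (generic_graph G)))"
  (is "strongly_shellable ?D")
proof -
  obtain w :: "'a \<times> 'a \<Rightarrow> nat" where w: "inj_on w (parcs G)"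
    "\<And>a b. a \<in> parcs G \<Longrightarrow> b \<in> parcs G \<Longrightarrow> side a \<subset> side b \<Longrightarrow> w a < w b"
    using exists_side_weight by blast
  have ne: "a \<noteq> b" if "side a \<inter> side b = {}" for a b
    using that fst_in_side by blast
  have sum: "sum w (parcs G - (parcs G - {a, b})) = w a + w b"
    if "a \<in> parcs G" "b \<in> parcs G" "side a \<inter> side b = {}" for a b
  proof -
    have "parcs G - (parcs G - {a, b}) = {a, b}" using that by blast
    then show ?thesis using ne that by simp
  qed
  show ?thesis
  \<comment> \<open>The complement of a facet is an edge, so the key is the total weight of that
    edge.\<close>
  proof (rule strongly_shellableI[where \<kappa> = "\<lambda>F. sum w (parcs G - F)"])
    show "finite (facets ?D)"
      unfolding facets_alexander_dual
      by (rule finite_subset[of _ "Pow (parcs G)"]) (use pair_finite_arcs in auto)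
    fix F H
    assume F: "F \<in> facets ?D" and H: "H \<in> facets ?D" and FH: "F \<noteq> H"
      and le: "sum w (parcs G - F) \<le> sum w (parcs G - H)"
    obtain a b where ab: "F = parcs G - {a, b}" "a \<in> parcs G" "b \<in> parcs G" "side a \<inter> side b = {}"
      using F by (auto simp: facets_alexander_dual)
    obtain c d where cd: "H = parcs G - {c, d}" "c \<in> parcs G" "d \<in> parcs G" "side c \<inter> side d = {}"
      using H by (auto simp: facets_alexander_dual)
    show "\<exists>K \<in> facets ?D. (K = F \<or> sum w (parcs G - K) < sum w (parcs G - H)) \<and>
        card (H - K) = 1 \<and> F \<inter> H \<subseteq> K \<and> K \<subseteq> F \<union> H"
    proof (cases "{a, b} \<inter> {c, d} = {}")
      case False
      \<comment> \<open>Edges sharing an end differ in one arc each, so \<open>F\<close> itself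
        serves as the witness.\<close>
      then have "H - F = {a} \<or> H - F = {b}"
        using ab cd FH ne[OF ab(4)] ne[OF cd(4)] by auto
      then have "card (H - F) = 1" by auto
      then show ?thesis using F by auto
    next
      case True
      moreover have "w a + w b \<le> w c + w d"
        using le sum[OF ab(2-4)] sum[OF cd(2-4)] by (simp add: ab(1) cd(1))
      ultimately obtain x y where xy: "x \<in> {a, b}" "y \<in> {c, d}" "side x \<inter> side y = {}"
          "w x + w y < w c + w d"
        using disjoint_sides_exchange[OF ab(2,3) cd(2,3) w ab(4) cd(4)] by blast
      \<comment> \<open>The lighter edge joins an end of each given edge. As these are disjoint,
        \<open>F \<union> H\<close> is all of \<open>parcs G\<close>, and \<open>K\<close> contains
        \<open>F \<inter> H\<close> because it omits only ends of the two.\<close>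
      define K where "K = parcs G - {x, y}"
      have E: "x \<in> parcs G" "y \<in> parcs G"
        using xy ab cd by auto
      have "H - K = {x}"
        using xy True E cd by (auto simp: K_def)
      moreover have "F \<inter> H \<subseteq> K" "K \<subseteq> F \<union> H"
        using xy True ab cd by (auto simp: K_def)
      moreover have "K \<in> facets ?D"
        using E xy(3) unfolding K_def facets_alexander_dual by blast
      moreover have "sum w (parcs G - K) < sum w (parcs G - H)"
        using sum[OF E xy(3)] sum[OF cd(2-4)] xy(4) by (simp add: K_def cd(1))
      ultimately show ?thesis
        by (intro bexI[of _ K]) simp_all
    qed
  qed
qed

end

theorem theorem4p24:
  fixes T :: "'a pair_pre_digraph"
  assumes "tree_graph T"
  shows "bi_SS_graph (generic_graph T)"
proof -
  interpret tree_digraph T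
  proof (intro tree_digraph.intro tree_digraph_axioms.intro)
    show "pair_graph T" "Digraph_Component.connected (with_proj T)"
      using assms by (simp_all add: tree_graph_def)
    show "length p < 3" if "pre_digraph.cycle (with_proj T) p" for p
      using assms that by (auto simp: tree_graph_def not_le[symmetric])
  qed
  show ?thesis
    unfolding bi_SS_graph_def bi_SS_def
    using independence_complex_strongly_shellable alexander_dual_strongly_shellable
    by (simp add: generic_graph_def)
qed

end
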